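(* Let $d$ be a series derivation on $\mathbb{K}$, $a\mapsto a'$, with $\phi'\neq0$ for all $\phi\in\Phi$. Then $d$ verifies both (HD2) for all $a,b\in\mathbb{K}\setminus\{0\}$ with $a\not\asymp1$ and $b\not\asymp 1$: $a\preccurlyeq b\Leftrightarrow a'\preccurlyeq b'$; and (HD3) for all $a,b\in\mathbb{K}$ with $|a|\succ|b|\succ1$: $\frac{a'}{a}\succcurlyeq\frac{b'}{b}$, and moreover $\frac{a'}{a}\asymp\frac{b'}{b}$ if and only if $a$ and $b$ are comparable; if and only if the following condition holds: (H3') for all $\phi\prec\psi$ in $\Phi$, $\theta^{(\phi)}\prec\theta^{(\psi)}$ and $\mathrm{LF}\left(\frac{\theta^{(\phi)}}{\theta^{(\psi)}}\right)\prec\psi$.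
   Context: Let $(\Phi,\preccurlyeq)$ be a totally ordered set (the fundamental monomials). A set is anti-well-ordered if each nonempty subset has a greatest element. The Hahn group $\mathbf{H}(\Phi)$ is the set of formal products $\gamma=\prod_{\phi\in\Phi}\phi^{\gamma_\phi}$ with $\gamma_\phi\in\mathbb{R}$ and $\mathrm{supp}\,\gamma:=\{\phi\in\Phi:\gamma_\phi\neq 0\}$ anti-well-ordered in $\Phi$; multiplication adds exponents pointwise, and $\gamma\succ 1$ iff $\gamma_\phi>0$ for $\phi=\max(\mathrm{supp}\,\gamma)$. This is a totally ordered abelian group, with $\Phi\subset\mathbf{H}(\Phi)$ as ordered set and $\phi\succ1$ for all $\phi\in\Phi$. Fix a subgroup $\Gamma$ of $\mathbf{H}(\Phi)$ with $\Phi\subset\Gamma$. For $\gamma\in\Gamma\setminus\{1\}$ put $\mathrm{LF}(\gamma):=\max(\mathrm{supp}\,\gamma)\in\Phi$, and $\mathrm{LF}(1):=1$. $\mathbb{K}:=\mathbb{R}((\Gamma))$ is the field of generalised series $a=\sum_{\alpha}a_\alpha\alpha$, i.e. maps $a:\Gamma\to\mathbb{R}$ whose support $\mathrm{Supp}\,a=\{\alpha\in\Gamma: a_\alpha\ne0\}$ is anti-well-ordered in $\Gamma$, with componentwise sum and convolution product. For $a\ne0$, $\mathrm{LM}(a):=\max(\mathrm{Supp}\,a)$, and $\mathrm{LM}(0):=0\prec\gamma$ for all $\gamma\in\Gamma$; $\mathbb{K}$ is ordered by the sign of the coefficient of $\mathrm{LM}(a)$, and $|a|=\max(a,-a)$ is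 the absolute value for this ordering. Define $a\preccurlyeq b\Leftrightarrow\mathrm{LM}(a)\preccurlyeq\mathrm{LM}(b)$ (and $\prec$ correspondingly), and $a\asymp b\Leftrightarrow\mathrm{LM}(a)=\mathrm{LM}(b)$. For $a\neq0$, $\mathrm{LF}(a):=\mathrm{LF}(\mathrm{LM}(a))$; two elements $a,b\succ1$ are comparable iff $\mathrm{LF}(a)=\mathrm{LF}(b)$. A family $(a_i)_{i\in I}$ in $\mathbb{K}$ is summable if $\bigcup_i\mathrm{Supp}\,a_i$ is anti-well-ordered in $\Gamma$ and for each $\alpha$ the set $\{i\in I:\alpha\in\mathrm{Supp}\,a_i\}$ is finite; its sum is then defined coefficientwise. A series derivation on $\mathbb{K}$ is a map $\mathbb{K}\to\mathbb{K}$, $a\mapsto a'$, such that: (D0) $1'=0$; (D1) for every $\alpha=\prod_\phi\phi^{\alpha_\phi}\in\Gamma$ the family $(\frac{\phi'}{\phi})_{\phi\in\mathrm{supp}\,\alpha}$ is summable and $\alpha'=\alpha\sum_{\phi\in\mathrm{supp}\,\alpha}\alpha_\phi\frac{\phi'}{\phi}$; (D2) for every $a=\sum_\alpha a_\alpha\alpha\in\mathbb{K}$ the family $(\alpha')_{\alpha\in\mathrm{Supp}\,a}$ is summable and $a'=\sum_{\alpha\in\mathrm{Supp}\,a}a_\alpha\alpha'$. For $\phi\in\Phi$, $\theta^{(\phi)}:=\mathrm{LM}(\phi'/\phi)\in\Gamma$. *)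

theory Defs
  imports Complex_Main "HOL-Library.Option_ord"
begin

section \<open>Anti-well-ordered sets\<close>

definition anti_well_ordered :: "'a::linorder set \<Rightarrow> bool" where
  "anti_well_ordered A \<longleftrightarrow> (\<forall>B\<subseteq>A. B \<noteq> {} \<longrightarrow> (\<exists>m\<in>B. \<forall>x\<in>B. x \<le> m))"

lemma anti_well_orderedE:
  assumes "anti_well_ordered A" "B \<subseteq> A" "x \<in> B"
  obtains m where "m \<in> B" "\<And>y. y \<in> B \<Longrightarrow> y \<le> m"
proof -
  have "\<exists>m\<in>B. \<forall>x\<in>B. x \<le> m"
    using assms(1)[unfolded anti_well_ordered_def, rule_format, OF assms(2)] assms(3) by blast
  then show ?thesis using that by blast
qed

lemma anti_well_ordered_subset:
  "anti_well_ordered A \<Longrightarrow> B \<subseteq> A \<Longrightarrow> anti_well_ordered B"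
  unfolding anti_well_ordered_def by (simp add: subset_trans)

lemma anti_well_ordered_empty [simp]: "anti_well_ordered {}"
  unfolding anti_well_ordered_def by simp

lemma anti_well_ordered_singleton [simp]: "anti_well_ordered {x}"
  unfolding anti_well_ordered_def by (auto simp: subset_singleton_iff)

lemma anti_well_ordered_Un:
  assumes "anti_well_ordered A" "anti_well_ordered B"
  shows "anti_well_ordered (A \<union> B)"
  unfolding anti_well_ordered_def
proof (intro allI impI)
  fix C assume C: "C \<subseteq> A \<union> B" "C \<noteq> {}"
  have 1: "C \<inter> A = {} \<or> (\<exists>m\<in>C \<inter> A. \<forall>x\<in>C \<inter> A. x \<le> m)"
    using assms(1) unfolding anti_well_ordered_def by (meson inf_le2)
  have 2: "C \<inter> B = {} \<or> (\<exists>m\<in>C \<inter> B. \<forall>x\<in>C \<inter> B. x \<le> m)"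
    using assms(2) unfolding anti_well_ordered_def by (meson inf_le2)
  show "\<exists>m\<in>C. \<forall>x\<in>C. x \<le> m"
  proof (cases "C \<inter> A = {} \<or> C \<inter> B = {}")
    case True
    then have "C \<subseteq> A \<or> C \<subseteq> B" using C(1) by blast
    then show ?thesis using assms C(2) unfolding anti_well_ordered_def by blast
  next
    case False
    then obtain m n where m: "m \<in> C \<inter> A" "\<forall>x\<in>C \<inter> A. x \<le> m"
      and n: "n \<in> C \<inter> B" "\<forall>x\<in>C \<inter> B. x \<le> n" using 1 2 by blast
    have "\<forall>x\<in>C. x \<le> max m n"
    proof
      fix x assume "x \<in> C"
      then have "x \<le> m \<or> x \<le> n" using m(2) n(2) C(1) by blast
      then show "x \<le> max m n" by (simp add: le_max_iff_disj)
    qed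
    moreover have "max m n \<in> C" using m n by (auto simp: max_def)
    ultimately show ?thesis by blast
  qed
qed

lemma anti_well_ordered_and_well_ordered_finite:
  fixes S :: "'a::linorder set"
  assumes "anti_well_ordered S"
    and wo: "\<And>B. B \<subseteq> S \<Longrightarrow> B \<noteq> {} \<Longrightarrow> \<exists>m\<in>B. \<forall>x\<in>B. m \<le> x"
  shows "finite S"
proof (rule ccontr)
  assume inf: "infinite S"
  define U where "U = {x\<in>S. infinite {y\<in>S. y \<le> x}}"
  obtain s where s: "s \<in> S" "\<And>y. y \<in> S \<Longrightarrow> y \<le> s"
    using anti_well_orderedE[OF assms(1) order_refl] inf by (metis finite.emptyI ex_in_conv)
  then have "{y\<in>S. y \<le> s} = S" by auto
  then have "s \<in> U" using s inf by (simp add: U_def)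
  then obtain u where u: "u \<in> U" "\<And>x. x \<in> U \<Longrightarrow> u \<le> x"
    using wo[of U] unfolding U_def by blast
  have "{y\<in>S. y \<le> u} \<subseteq> insert u {y\<in>S. y < u}" by auto
  then have inf2: "infinite {y\<in>S. y < u}"
    using u(1) unfolding U_def by (metis (no_types, lifting) finite_insert mem_Collect_eq rev_finite_subset)
  then obtain y where "y \<in> {y\<in>S. y < u}" by (metis (no_types, lifting) finite.emptyI ex_in_conv)
  then obtain v where v: "v \<in> {y\<in>S. y < u}" "\<And>y. y \<in> {y\<in>S. y < u} \<Longrightarrow> y \<le> v"
    using anti_well_orderedE[OF assms(1), of "{y\<in>S. y < u}"] by auto
  have "{y\<in>S. y < u} \<subseteq> {y\<in>S. y \<le> v}" using v by auto
  then have "v \<in> U" using v(1) inf2 unfolding U_def using finite_subset by auto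
  then show False using u(2)[of v] v(1) by auto
qed

lemma anti_well_ordered_sumset:
  fixes A B :: "'a::linordered_ab_group_add set"
  assumes A: "anti_well_ordered A" and B: "anti_well_ordered B"
  shows "anti_well_ordered {a + b |a b. a \<in> A \<and> b \<in> B}"
  unfolding anti_well_ordered_def
proof (intro allI impI)
  fix C assume C: "C \<subseteq> {a + b |a b. a \<in> A \<and> b \<in> B}" "C \<noteq> {}"
  define P where "P = {(a, b). a \<in> A \<and> b \<in> B \<and> a + b \<in> C}"
  define Q where "Q = {(a, b). (a, b) \<in> P \<and> (\<forall>(a', b')\<in>P. a + b \<le> a' + b' \<longrightarrow> a' \<le> a)}"
  show "\<exists>m\<in>C. \<forall>x\<in>C. x \<le> m"
  proof (rule ccontr)
    assume neg: "\<not> (\<exists>m\<in>C. \<forall>x\<in>C. x \<le> m)"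
    have step: "\<exists>a' b'. (a', b') \<in> Q \<and> c < a' + b'" if c: "c \<in> C" for c
    proof -
      define E where "E = {a. \<exists>b. (a, b) \<in> P \<and> c < a + b}"
      obtain c' where "c' \<in> C" "c < c'" using neg c by (meson not_le)
      moreover then obtain a b where "a \<in> A" "b \<in> B" "c' = a + b" using C by blast
      ultimately have "a \<in> E" unfolding E_def P_def by auto
      moreover have "E \<subseteq> A" unfolding E_def P_def by auto
      ultimately obtain a' where a': "a' \<in> E" "\<And>y. y \<in> E \<Longrightarrow> y \<le> a'"
        using anti_well_orderedE[OF A] by metis
      then obtain b' where b': "(a', b') \<in> P" "c < a' + b'" unfolding E_def by auto
      have "(a', b') \<in> Q"
        unfolding Q_def using b' a'(2) unfolding E_def by fastforce
      then show ?thesis using b' by blast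
    qed
    define D where "D = snd ` Q"
    have DB: "D \<subseteq> B" unfolding D_def Q_def P_def by auto
    obtain c where "c \<in> C" using C by blast
    then obtain b where "b \<in> D" using step unfolding D_def by force
    then obtain b where b: "b \<in> D" "\<And>y. y \<in> D \<Longrightarrow> y \<le> b"
      using anti_well_orderedE[OF B DB] by metis
    then obtain a where a: "(a, b) \<in> Q" unfolding D_def by auto
    then have "a + b \<in> C" unfolding Q_def P_def by auto
    then obtain a' b' where 1: "(a', b') \<in> Q" "a + b < a' + b'" using step by blast
    then have "a' \<le> a" using a unfolding Q_def by fastforce
    moreover have "b' \<le> b" using b(2) 1(1) unfolding D_def by force
    ultimately show False using 1(2) by (meson add_mono not_le)
  qed
qed

lemma anti_well_ordered_finite_decompositions:
  fixes A B :: "'a::linordered_ab_group_add set"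
  assumes A: "anti_well_ordered A" and B: "anti_well_ordered B"
  shows "finite {a. a \<in> A \<and> c - a \<in> B}"
proof (rule anti_well_ordered_and_well_ordered_finite)
  show "anti_well_ordered {a. a \<in> A \<and> c - a \<in> B}"
    by (rule anti_well_ordered_subset[OF A]) blast
  fix D assume D: "D \<subseteq> {a. a \<in> A \<and> c - a \<in> B}" "D \<noteq> {}"
  then obtain d where d: "c - d \<in> (\<lambda>a. c - a) ` D" by blast
  have DB: "(\<lambda>a. c - a) ` D \<subseteq> B" using D by auto
  obtain m where m: "m \<in> (\<lambda>a. c - a) ` D" "\<And>y. y \<in> (\<lambda>a. c - a) ` D \<Longrightarrow> y \<le> m"
    by (rule anti_well_orderedE[OF B DB d]) blast
  obtain e where e: "e \<in> D" "m = c - e" using m(1) by blast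
  have "e \<le> x" if "x \<in> D" for x
  proof -
    have "c - x \<in> (\<lambda>a. c - a) ` D" using that by (rule imageI)
    then have "c - x \<le> c - e" using m(2) e(2) by blast
    then show ?thesis by simp
  qed
  then show "\<exists>m\<in>D. \<forall>x\<in>D. m \<le> x" using e(1) by blast
qed


section \<open>Hahn products and generalised series\<close>

text \<open>
  One type constructor serves twice.  For a chain \<open>'p\<close> of fundamental monomials, an element of
  \<open>'p hahn\<close> is a formal product of real powers of elements of \<open>'p\<close>; the function is the family of
  exponents.  For an ordered abelian group \<open>'g\<close>, an element of \<open>'g hahn\<close> is a generalised series
  with real coefficients and monomials in \<open>'g\<close>.

  Groups of monomials are written additively, so that the library class
  \<^class>\<open>linordered_ab_group_add\<close> applies: the monomial \<open>1\<close> is \<open>0\<close>, a product of monomials is a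
  sum, a quotient is a difference.  Inside the field of series the usual notation is kept.
\<close>

typedef (overloaded) 'a hahn = "{f :: 'a::linorder \<Rightarrow> real. anti_well_ordered {x. f x \<noteq> 0}}"
  morphisms coeff Abs_hahn
  by (rule exI[of _ "\<lambda>_. 0"]) simp

setup_lifting type_definition_hahn

definition supp :: "'a::linorder hahn \<Rightarrow> 'a set" where
  "supp a = {x. coeff a x \<noteq> 0}"

text \<open>The greatest element of the support; meaningful for \<open>a \<noteq> 0\<close> only.\<close>
definition lead :: "'a::linorder hahn \<Rightarrow> 'a" where
  "lead a = (GREATEST x. x \<in> supp a)"

lift_definition single :: "real \<Rightarrow> 'a::linorder \<Rightarrow> 'a hahn" is
  "\<lambda>c x y. if y = x then c else 0"
  by (rule anti_well_ordered_subset[OF anti_well_ordered_singleton]) auto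

text \<open>Both the inclusion of the fundamental monomials into the Hahn group and that of the monomials
  into the field of series.\<close>
abbreviation monomial :: "'a::linorder \<Rightarrow> 'a hahn" where
  "monomial \<equiv> single 1"

instantiation hahn :: (linorder) "{ab_group_add, real_vector, linorder}"
begin

lift_definition zero_hahn :: "'a hahn" is "\<lambda>_. 0" by simp

lift_definition plus_hahn :: "'a hahn \<Rightarrow> 'a hahn \<Rightarrow> 'a hahn" is "\<lambda>f g x. f x + g x"
  by (rule anti_well_ordered_subset, erule (1) anti_well_ordered_Un) auto

lift_definition uminus_hahn :: "'a hahn \<Rightarrow> 'a hahn" is "\<lambda>f x. - f x" by simp

lift_definition minus_hahn :: "'a hahn \<Rightarrow> 'a hahn \<Rightarrow> 'a hahn" is "\<lambda>f g x. f x - g x"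
  by (rule anti_well_ordered_subset, erule (1) anti_well_ordered_Un) auto

lift_definition scaleR_hahn :: "real \<Rightarrow> 'a hahn \<Rightarrow> 'a hahn" is "\<lambda>r f x. r * f x"
  by (erule anti_well_ordered_subset) auto

definition less_hahn :: "'a hahn \<Rightarrow> 'a hahn \<Rightarrow> bool" where
  "(a::'a hahn) < b \<longleftrightarrow> b - a \<noteq> 0 \<and> coeff (b - a) (lead (b - a)) > 0"

definition less_eq_hahn :: "'a hahn \<Rightarrow> 'a hahn \<Rightarrow> bool" where
  "(a::'a hahn) \<le> b \<longleftrightarrow> a = b \<or> a < b"

lemma supp_anti_well_ordered: "anti_well_ordered (supp a)"
  unfolding supp_def using coeff by auto

lemma hahn_eqI: "(\<And>x. coeff a x = coeff b x) \<Longrightarrow> a = b"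
  by (simp add: coeff_inject[symmetric] fun_eq_iff)

lemma coeff_simps [simp]:
  "coeff 0 x = 0" "coeff (a + b) x = coeff a x + coeff b x"
  "coeff (a - b) x = coeff a x - coeff b x" "coeff (- a) x = - coeff a x"
  "coeff (c *\<^sub>R a) x = c * coeff a x" "coeff (single c z) x = (if x = z then c else 0)"
  by (transfer, simp)+

lemma hahn_eq_0_iff: "a = 0 \<longleftrightarrow> supp a = {}"
  unfolding supp_def by (metis (mono_tags, lifting) Collect_empty_eq coeff_simps(1) hahn_eqI)

lemma lead_props:
  assumes "a \<noteq> 0"
  shows "lead a \<in> supp a" "x \<in> supp a \<Longrightarrow> x \<le> lead a"
proof -
  obtain m where "m \<in> supp a" "\<And>y. y \<in> supp a \<Longrightarrow> y \<le> m"
    using anti_well_orderedE[OF supp_anti_well_ordered order_refl] assms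
    by (metis hahn_eq_0_iff ex_in_conv)
  moreover then have "lead a = m" unfolding lead_def by (intro Greatest_equality)
  ultimately show "lead a \<in> supp a" "x \<in> supp a \<Longrightarrow> x \<le> lead a" by auto
qed

lemma lead_eqI: "x \<in> supp a \<Longrightarrow> (\<And>y. y \<in> supp a \<Longrightarrow> y \<le> x) \<Longrightarrow> lead a = x"
  unfolding lead_def by (intro Greatest_equality)

lemma hahn_pos_iff: "(0::'a hahn) < a \<longleftrightarrow> (\<exists>x. coeff a x > 0 \<and> (\<forall>y. coeff a y \<noteq> 0 \<longrightarrow> y \<le> x))"
  (is "_ \<longleftrightarrow> ?R")
proof
  assume "0 < a"
  moreover have "a - 0 = a" by (rule hahn_eqI) simp
  ultimately have "a \<noteq> 0" "coeff a (lead a) > 0" by (simp_all add: less_hahn_def)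
  then show ?R using lead_props(2)[of a] by (auto simp: supp_def)
next
  assume ?R
  then obtain x where x: "coeff a x > 0" "\<forall>y. coeff a y \<noteq> 0 \<longrightarrow> y \<le> x" by blast
  then have "lead a = x" by (intro lead_eqI) (auto simp: supp_def)
  moreover have "a - 0 = a" by (rule hahn_eqI) simp
  moreover have "a \<noteq> 0" using x by auto
  ultimately show "0 < a" using x by (simp add: less_hahn_def)
qed

lemma hahn_less_iff_diff: "(a::'a hahn) < b \<longleftrightarrow> 0 < b - a"
proof -
  have "b - a - 0 = b - a" by (rule hahn_eqI) simp
  then show ?thesis by (simp add: less_hahn_def)
qed

lemma hahn_pos_add:
  assumes "(0::'a hahn) < a" "0 < b" shows "0 < a + b"
proof -
  obtain x y where x: "coeff a x > 0" "\<forall>y. coeff a y \<noteq> 0 \<longrightarrow> y \<le> x"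
    and y: "coeff b y > 0" "\<forall>z. coeff b z \<noteq> 0 \<longrightarrow> z \<le> y"
    using assms unfolding hahn_pos_iff by blast
  have "coeff a (max x y) \<ge> 0" "coeff b (max x y) \<ge> 0"
    using x y by (smt (verit) max_def order_antisym)+
  moreover have "coeff a (max x y) > 0 \<or> coeff b (max x y) > 0"
    using x y by (auto simp: max_def)
  ultimately have "coeff (a + b) (max x y) > 0" by auto
  moreover have "z \<le> max x y" if "coeff (a + b) z \<noteq> 0" for z
  proof (cases "coeff a z = 0")
    case True
    then show ?thesis using that y(2) by (simp add: le_max_iff_disj)
  next
    case False
    then show ?thesis using x(2) by (simp add: le_max_iff_disj)
  qed
  ultimately show ?thesis unfolding hahn_pos_iff by blast
qed

lemma hahn_pos_linear: "a = 0 \<or> (0::'a hahn) < a \<or> 0 < - a"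
proof (cases "a = 0")
  case False
  then have "lead a \<in> supp a" "\<And>x. x \<in> supp a \<Longrightarrow> x \<le> lead a" by (rule lead_props)+
  then show ?thesis unfolding hahn_pos_iff supp_def
    by simp (metis linorder_neqE_linordered_idom)
qed simp

lemma hahn_not_pos_0: "\<not> (0::'a hahn) < 0"
  by (simp add: hahn_pos_iff)

instance
proof
  fix a b c :: "'a hahn" and r s :: real
  show "a + b + c = a + (b + c)" "a + b = b + a" "0 + a = a" "- a + a = 0" "a - b = a + - b"
    "r *\<^sub>R (a + b) = r *\<^sub>R a + r *\<^sub>R b" "(r + s) *\<^sub>R a = r *\<^sub>R a + s *\<^sub>R a"
    "r *\<^sub>R s *\<^sub>R a = (r * s) *\<^sub>R a" "1 *\<^sub>R a = a"
    by (rule hahn_eqI; simp add: algebra_simps)+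
  have tr: "a < c" if "a < b" "b < c" for a b c :: "'a hahn"
  proof -
    have "c - a = (c - b) + (b - a)" by (rule hahn_eqI) simp
    then show ?thesis using that hahn_pos_add hahn_less_iff_diff by metis
  qed
  have irr: "\<not> a < a" for a :: "'a hahn"
    using hahn_not_pos_0 by (simp add: less_hahn_def hahn_eqI)
  show "(a < b) = (a \<le> b \<and> \<not> b \<le> a)" using tr[of a b a] tr[of b a b] irr[of a] irr[of b] unfolding less_eq_hahn_def by metis
  show "a \<le> a" by (simp add: less_eq_hahn_def)
  show "a \<le> b \<Longrightarrow> b \<le> c \<Longrightarrow> a \<le> c" using tr[of a b c] unfolding less_eq_hahn_def by metis
  show "a \<le> b \<Longrightarrow> b \<le> a \<Longrightarrow> a = b" using tr[of a b a] irr[of a] unfolding less_eq_hahn_def by metis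
  have "- (b - a) = a - b" by (rule hahn_eqI) simp
  moreover have "b - a = 0 \<Longrightarrow> a = b" by (rule hahn_eqI) (metis coeff_simps(1,3) eq_iff_diff_eq_0)
  ultimately show "a \<le> b \<or> b \<le> a"
    using hahn_pos_linear[of "b - a"] unfolding less_eq_hahn_def
    by (metis hahn_less_iff_diff)
qed

end

instance hahn :: (linorder) linordered_ab_group_add
proof
  fix a b c :: "'a hahn"
  assume "a \<le> b"
  then show "c + a \<le> c + b" 
    by (auto simp: less_eq_hahn_def hahn_less_iff_diff[of a b] hahn_less_iff_diff[of "c + a" "c + b"])
qed


section \<open>The field of generalised series\<close>

instantiation hahn :: (linordered_ab_group_add) "{times, one, abs, sgn, inverse}"
begin

lift_definition one_hahn :: "'a hahn" is "\<lambda>x. if x = 0 then 1 else 0"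
  by (rule anti_well_ordered_subset[OF anti_well_ordered_singleton[of 0]]) auto

lift_definition times_hahn :: "'a hahn \<Rightarrow> 'a hahn \<Rightarrow> 'a hahn" is
  "\<lambda>f g c. \<Sum>x | f x \<noteq> 0 \<and> g (c - x) \<noteq> 0. f x * g (c - x)"
proof -
  fix f g :: "'a \<Rightarrow> real"
  assume fg: "anti_well_ordered {x. f x \<noteq> 0}" "anti_well_ordered {x. g x \<noteq> 0}"
  have "{c. (\<Sum>x | f x \<noteq> 0 \<and> g (c - x) \<noteq> 0. f x * g (c - x)) \<noteq> 0}
      \<subseteq> {a + b |a b. a \<in> {x. f x \<noteq> 0} \<and> b \<in> {x. g x \<noteq> 0}}"
  proof
    fix c assume "c \<in> {c. (\<Sum>x | f x \<noteq> 0 \<and> g (c - x) \<noteq> 0. f x * g (c - x)) \<noteq> 0}"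
    then obtain x where x: "f x \<noteq> 0" "g (c - x) \<noteq> 0"
      by (auto elim: sum.not_neutral_contains_not_neutral)
    have "c = x + (c - x)" by simp
    then show "c \<in> {a + b |a b. a \<in> {x. f x \<noteq> 0} \<and> b \<in> {x. g x \<noteq> 0}}"
      using x by blast
  qed
  then show "anti_well_ordered {c. (\<Sum>x | f x \<noteq> 0 \<and> g (c - x) \<noteq> 0. f x * g (c - x)) \<noteq> 0}"
    by (rule anti_well_ordered_subset[OF anti_well_ordered_sumset[OF fg]])
qed

definition abs_hahn :: "'a hahn \<Rightarrow> 'a hahn" where
  "\<bar>a::'a hahn\<bar> = max a (- a)"

definition sgn_hahn :: "'a hahn \<Rightarrow> 'a hahn" where
  "sgn (a::'a hahn) = (if a = 0 then 0 else if 0 < a then 1 else - 1)"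

definition inverse_hahn :: "'a hahn \<Rightarrow> 'a hahn" where
  "inverse (a::'a hahn) = (if a = 0 then 0 else THE b. a * b = 1)"

definition divide_hahn :: "'a hahn \<Rightarrow> 'a hahn \<Rightarrow> 'a hahn" where
  "(a::'a hahn) div b = a * inverse b"

instance ..

end

lemma coeff_one [simp]: "coeff (1::'a::linordered_ab_group_add hahn) x = (if x = 0 then 1 else 0)"
  by transfer simp

lemma one_hahn_eq_monomial: "(1::'a::linordered_ab_group_add hahn) = monomial 0"
  by (rule hahn_eqI) simp

lemma finite_convolution:
  "finite {x. coeff a x \<noteq> 0 \<and> coeff b (c - x) \<noteq> 0}" for c :: "'a::linordered_ab_group_add"
  using anti_well_ordered_finite_decompositions[OF supp_anti_well_ordered[of a] supp_anti_well_ordered[of b]]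
  by (simp add: supp_def)

lemma coeff_times:
  "coeff (a * b) c = (\<Sum>x | coeff a x \<noteq> 0 \<and> coeff b (c - x) \<noteq> 0. coeff a x * coeff b (c - x))"
  by transfer simp

lemma coeff_times_superset:
  assumes "finite F" "\<And>x. coeff a x \<noteq> 0 \<Longrightarrow> coeff b (c - x) \<noteq> 0 \<Longrightarrow> x \<in> F"
  shows "coeff (a * b) c = (\<Sum>x\<in>F. coeff a x * coeff b (c - x))"
  unfolding coeff_times using assms by (intro sum.mono_neutral_left) auto

lemma coeff_times_nonzeroE:
  assumes "coeff (a * b) c \<noteq> 0"
  obtains x where "coeff a x \<noteq> 0" "coeff b (c - x) \<noteq> 0"
  using assms unfolding coeff_times by (auto elim: sum.not_neutral_contains_not_neutral)

instance hahn :: (linordered_ab_group_add) comm_ring_1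
proof
  fix a b c :: "'a hahn"
  show "a * b = b * a"
  proof (rule hahn_eqI)
    fix x
    show "coeff (a * b) x = coeff (b * a) x" unfolding coeff_times
      by (rule sum.reindex_bij_witness[of _ "\<lambda>y. x - y" "\<lambda>y. x - y"]) auto
  qed
  show "1 * a = a"
  proof (rule hahn_eqI)
    fix x
    have "coeff (1 * a) x = (\<Sum>y\<in>{0}. coeff 1 y * coeff a (x - y))"
      by (rule coeff_times_superset) (auto split: if_splits)
    then show "coeff (1 * a) x = coeff a x" by simp
  qed
  show "(a + b) * c = a * c + b * c"
  proof (rule hahn_eqI)
    fix x
    define F where "F = {y. coeff a y \<noteq> 0 \<and> coeff c (x - y) \<noteq> 0} \<union> {y. coeff b y \<noteq> 0 \<and> coeff c (x - y) \<noteq> 0}"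
    have F: "finite F" unfolding F_def using finite_convolution by blast
    have "coeff ((a + b) * c) x = (\<Sum>y\<in>F. coeff (a + b) y * coeff c (x - y))"
      by (rule coeff_times_superset[OF F]) (auto simp: F_def)
    moreover have "coeff (a * c) x = (\<Sum>y\<in>F. coeff a y * coeff c (x - y))"
      by (rule coeff_times_superset[OF F]) (auto simp: F_def)
    moreover have "coeff (b * c) x = (\<Sum>y\<in>F. coeff b y * coeff c (x - y))"
      by (rule coeff_times_superset[OF F]) (auto simp: F_def)
    ultimately show "coeff ((a + b) * c) x = coeff (a * c + b * c) x"
      by (simp add: sum.distrib algebra_simps)
  qed
  have "coeff (1::'a hahn) 0 \<noteq> coeff (0::'a hahn) 0" by simp
  then show "(0::'a hahn) \<noteq> 1" by metis
  show "a * b * c = a * (b * c)"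
  proof (rule hahn_eqI)
    fix x
    define T where "T = {(d, y). coeff a y \<noteq> 0 \<and> coeff b (d - y) \<noteq> 0 \<and> coeff c (x - d) \<noteq> 0}"
    have "finite {d. d \<in> {y + z |y z. y \<in> supp a \<and> z \<in> supp b} \<and> x - d \<in> supp c}"
      by (intro anti_well_ordered_finite_decompositions anti_well_ordered_sumset supp_anti_well_ordered)
    then have fin: "finite (SIGMA d : {d. d \<in> {y + z |y z. y \<in> supp a \<and> z \<in> supp b} \<and> x - d \<in> supp c}.
        {y. coeff a y \<noteq> 0 \<and> coeff b (d - y) \<noteq> 0})"
      by (intro finite_SigmaI finite_convolution)
    have "T \<subseteq> (SIGMA d : {d. d \<in> {y + z |y z. y \<in> supp a \<and> z \<in> supp b} \<and> x - d \<in> supp c}.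
        {y. coeff a y \<noteq> 0 \<and> coeff b (d - y) \<noteq> 0})"
    proof
      fix t assume "t \<in> T"
      then obtain d y where t: "t = (d, y)" "coeff a y \<noteq> 0" "coeff b (d - y) \<noteq> 0" "coeff c (x - d) \<noteq> 0"
        unfolding T_def by auto
      moreover have "d = y + (d - y)" by simp
      ultimately show "t \<in> (SIGMA d : {d. d \<in> {y + z |y z. y \<in> supp a \<and> z \<in> supp b} \<and> x - d \<in> supp c}.
        {y. coeff a y \<noteq> 0 \<and> coeff b (d - y) \<noteq> 0})"
        unfolding supp_def by blast
    qed
    then have T: "finite T" using fin finite_subset by blast
    define F where "F = fst ` T"
    define G where "G = snd ` T"
    have FG: "finite F" "finite G" using T by (auto simp: F_def G_def)
    have inF: "d \<in> F" and inG: "y \<in> G"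
      if "coeff a y \<noteq> 0" "coeff b (d - y) \<noteq> 0" "coeff c (x - d) \<noteq> 0" for d y
      using that unfolding F_def G_def T_def by force+
    have "coeff (a * b * c) x = (\<Sum>d\<in>F. coeff (a * b) d * coeff c (x - d))"
      using inF by (intro coeff_times_superset[OF FG(1)]) (metis coeff_times_nonzeroE)
    also have "\<dots> = (\<Sum>d\<in>F. \<Sum>y\<in>G. coeff a y * coeff b (d - y) * coeff c (x - d))"
    proof (rule sum.cong[OF refl])
      fix d
      show "coeff (a * b) d * coeff c (x - d) = (\<Sum>y\<in>G. coeff a y * coeff b (d - y) * coeff c (x - d))"
      proof (cases "coeff c (x - d) = 0")
        case False
        then have "coeff (a * b) d = (\<Sum>y\<in>G. coeff a y * coeff b (d - y))"
          using inG by (intro coeff_times_superset[OF FG(2)])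
        then show ?thesis by (simp add: sum_distrib_right)
      qed simp
    qed
    also have "\<dots> = (\<Sum>y\<in>G. \<Sum>d\<in>F. coeff a y * coeff b (d - y) * coeff c (x - d))"
      by (rule sum.swap)
    also have "\<dots> = (\<Sum>y\<in>G. coeff a y * coeff (b * c) (x - y))"
    proof (rule sum.cong[OF refl])
      fix y
      show "(\<Sum>d\<in>F. coeff a y * coeff b (d - y) * coeff c (x - d)) = coeff a y * coeff (b * c) (x - y)"
      proof (cases "coeff a y = 0")
        case False
        have "coeff (b * c) (x - y) = (\<Sum>z\<in>(\<lambda>d. d - y) ` F. coeff b z * coeff c (x - y - z))"
        proof (rule coeff_times_superset)
          fix z assume "coeff b z \<noteq> 0" "coeff c (x - y - z) \<noteq> 0"
          then have "z + y \<in> F" using inF[of y "z + y"] False by (simp add: algebra_simps)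
          then show "z \<in> (\<lambda>d. d - y) ` F" by (metis add_diff_cancel_right' imageI)
        qed (use FG in simp)
        also have "\<dots> = (\<Sum>d\<in>F. coeff b (d - y) * coeff c (x - d))"
          by (subst sum.reindex) (auto simp: inj_on_def)
        finally show ?thesis by (simp add: sum_distrib_left algebra_simps)
      qed simp
    qed
    also have "\<dots> = coeff (a * (b * c)) x"
      using inG coeff_times_nonzeroE[of b c]
    proof (intro coeff_times_superset[OF FG(2), symmetric])
      fix y assume y: "coeff a y \<noteq> 0" "coeff (b * c) (x - y) \<noteq> 0"
      obtain z where "coeff b z \<noteq> 0" "coeff c (x - y - z) \<noteq> 0"
        using coeff_times_nonzeroE[OF y(2)] by blast
      then show "y \<in> G" using inG[of y "z + y"] y(1) by (simp add: algebra_simps)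
    qed
    finally show "coeff (a * b * c) x = coeff (a * (b * c)) x" .
  qed
qed

lemma lead_times:
  fixes a b :: "'a::linordered_ab_group_add hahn"
  assumes "a \<noteq> 0" "b \<noteq> 0"
  shows "coeff (a * b) (lead a + lead b) = coeff a (lead a) * coeff b (lead b)"
    and "coeff (a * b) x \<noteq> 0 \<Longrightarrow> x \<le> lead a + lead b"
proof -
  note la = lead_props[OF assms(1)] and lb = lead_props[OF assms(2)]
  have "coeff (a * b) (lead a + lead b) = (\<Sum>y\<in>{lead a}. coeff a y * coeff b (lead a + lead b - y))"
  proof (rule coeff_times_superset)
    fix y assume y: "coeff a y \<noteq> 0" "coeff b (lead a + lead b - y) \<noteq> 0"
    then have "y \<le> lead a" "lead a + lead b - y \<le> lead b" using la lb by (auto simp: supp_def)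
    then show "y \<in> {lead a}" by (simp add: algebra_simps)
  qed simp
  then show "coeff (a * b) (lead a + lead b) = coeff a (lead a) * coeff b (lead b)" by simp
  assume "coeff (a * b) x \<noteq> 0"
  then obtain y where "coeff a y \<noteq> 0" "coeff b (x - y) \<noteq> 0" by (rule coeff_times_nonzeroE)
  then have "y \<le> lead a" "x - y \<le> lead b" using la lb by (auto simp: supp_def)
  then have "y + (x - y) \<le> lead a + lead b" by (rule add_mono)
  then show "x \<le> lead a + lead b" by simp
qed

instance hahn :: (linordered_ab_group_add) linordered_idom
proof
  fix a b c :: "'a hahn"
  have pos: "0 < a * b" if "0 < a" "0 < b" for a b :: "'a hahn"
  proof -
    have "a \<noteq> 0" "b \<noteq> 0" "coeff a (lead a) > 0" "coeff b (lead b) > 0"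
      using that by (auto simp: less_hahn_def)
    then show ?thesis unfolding hahn_pos_iff
      by (metis lead_times zero_less_mult_iff)
  qed
  show "a < b \<Longrightarrow> 0 < c \<Longrightarrow> c * a < c * b"
    using pos[of c "b - a"] by (simp add: right_diff_distrib)
  show "\<bar>a\<bar> = (if a < 0 then - a else a)" unfolding abs_hahn_def max_def by auto
  show "sgn a = (if a = 0 then 0 else if 0 < a then 1 else - 1)" by (rule sgn_hahn_def)
qed

text \<open>Existence of inverses: a maximal approximate inverse, with respect to truncation, is exact.\<close>

lemma hahn_inverse_exists:
  fixes a :: "'a::linordered_ab_group_add hahn"
  assumes "a \<noteq> 0"
  shows "\<exists>b. a * b = 1"
proof -
  define P where "P = {b. \<forall>x\<in>supp b. \<forall>y\<in>supp (1 - a * b). y < lead a + x}"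
  define le where "le = (\<lambda>b b' :: 'a hahn. \<forall>x\<in>supp b. \<forall>y\<ge>x. coeff b' y = coeff b y)"
  note la = lead_props[OF assms]
  have le_supp: "x \<in> supp b'" if "le b b'" "x \<in> supp b" for b b' x
    using that unfolding le_def supp_def by auto
  have "\<exists>m\<in>P. \<forall>b\<in>P. le m b \<longrightarrow> b = m"
  proof (rule predicate_Zorn)
    show "partial_order_on P (relation_of le P)"
    proof (rule partial_order_on_relation_ofI)
      show "le b b" for b by (simp add: le_def)
      show "le b b''" if "le b b'" "le b' b''" for b b' b''
        using that le_supp[OF that(1)] unfolding le_def by metis
      show "b = b'" if "le b b'" "le b' b" for b b'
      proof (rule hahn_eqI)
        fix x show "coeff b x = coeff b' x"
          using that unfolding le_def supp_def by (metis (mono_tags) mem_Collect_eq order_refl)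
      qed
    qed
    fix C assume C: "C \<in> Chains (relation_of le P)"
    then have CP: "C \<subseteq> P" unfolding Chains_def relation_of_def by auto
    have chain: "le b b' \<or> le b' b" if "b \<in> C" "b' \<in> C" for b b'
      using C that unfolding Chains_def relation_of_def by auto
    have agree: "coeff b' y = coeff b y"
      if "b \<in> C" "b' \<in> C" "x \<in> supp b" "x \<le> y" "y \<in> supp b'" for b b' x y
      using chain[OF that(1,2)] that(3-5) unfolding le_def by (metis order_refl)
    define f where "f = (\<lambda>x. if \<exists>b\<in>C. x \<in> supp b then coeff (SOME b. b \<in> C \<and> x \<in> supp b) x else 0)"
    have f_eq: "f y = coeff b y" if "b \<in> C" "x \<in> supp b" "x \<le> y" for b x y
    proof (cases "\<exists>b\<in>C. y \<in> supp b")
      case True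
      then have "(SOME b. b \<in> C \<and> y \<in> supp b) \<in> C \<and> y \<in> supp (SOME b. b \<in> C \<and> y \<in> supp b)"
        by (metis (mono_tags, lifting) someI_ex)
      then have "coeff (SOME b. b \<in> C \<and> y \<in> supp b) y = coeff b y"
        using agree[OF that(1) _ that(2,3)] by blast
      then show ?thesis using True by (simp add: f_def)
    next
      case False
      then show ?thesis using that by (auto simp: f_def supp_def)
    qed
    have f_supp: "\<exists>b\<in>C. x \<in> supp b" if "f x \<noteq> 0" for x
      using that unfolding f_def by meson
    have "anti_well_ordered {x. f x \<noteq> 0}" unfolding anti_well_ordered_def
    proof (intro allI impI)
      fix S assume S: "S \<subseteq> {x. f x \<noteq> 0}" "S \<noteq> {}"
      then obtain x where x: "x \<in> S" by auto
      then obtain b where b: "b \<in> C" "x \<in> supp b" using S f_supp by blast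
      obtain m where m: "m \<in> S \<inter> supp b" "\<And>y. y \<in> S \<inter> supp b \<Longrightarrow> y \<le> m"
        using anti_well_orderedE[OF supp_anti_well_ordered[of b], of "S \<inter> supp b" x] x b by blast
      have "y \<le> m" if "y \<in> S" for y
      proof (cases "x \<le> y")
        case True
        then have "y \<in> supp b" using f_eq[OF b True] that S by (auto simp: supp_def)
        then show ?thesis using m that by auto
      next
        case False
        then show ?thesis using m(2)[of x] x b by auto
      qed
      then show "\<exists>m\<in>S. \<forall>x\<in>S. x \<le> m" using m by blast
    qed
    then have cu: "coeff (Abs_hahn f) x = f x" for x by (simp add: Abs_hahn_inverse)
    define u where "u = Abs_hahn f"
    have ub: "le b u" if "b \<in> C" for b
      unfolding le_def u_def cu using f_eq[OF that] by auto
    have "u \<in> P" unfolding P_def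
    proof (safe)
      fix x y assume x: "x \<in> supp u" and y: "y \<in> supp (1 - a * u)"
      obtain b where b: "b \<in> C" "x \<in> supp b" using x f_supp unfolding supp_def u_def cu by blast
      have "1 - a * u = (1 - a * b) - a * (u - b)" by (simp add: algebra_simps)
      then have "y \<in> supp (1 - a * b) \<or> y \<in> supp (a * (u - b))"
        using y unfolding supp_def by (metis (mono_tags) coeff_simps(3) diff_self mem_Collect_eq diff_zero)
      then show "y < lead a + x"
      proof
        assume "y \<in> supp (1 - a * b)"
        then show ?thesis using b CP unfolding P_def by blast
      next
        assume "y \<in> supp (a * (u - b))"
        then obtain z where z: "coeff a z \<noteq> 0" "coeff (u - b) (y - z) \<noteq> 0"
          unfolding supp_def using coeff_times_nonzeroE by blast
        have "y - z < x"
          using z(2) ub[OF b(1)] b(2) unfolding le_def by (metis coeff_simps(3) diff_self not_le)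
        moreover have "z \<le> lead a" using z la by (simp add: supp_def)
        ultimately have "z + (y - z) < lead a + x" by (rule add_le_less_mono[rotated])
        then show ?thesis by simp
      qed
    qed
    then show "\<exists>u\<in>P. \<forall>b\<in>C. le b u" using ub by blast
  qed
  then obtain b where b: "b \<in> P" "\<And>b'. b' \<in> P \<Longrightarrow> le b b' \<Longrightarrow> b' = b" by blast
  have "1 - a * b = 0"
  proof (rule ccontr)
    assume r: "1 - a * b \<noteq> 0"
    define r where "r = 1 - a * b"
    have r0: "r \<noteq> 0" using r r_def by simp
    note lr = lead_props[OF r0]
    define z where "z = lead r - lead a"
    define c where "c = coeff r (lead r) / coeff a (lead a)"
    have c0: "c \<noteq> 0" using lr(1) la(1) by (simp add: c_def supp_def)
    have small: "z < x" if "x \<in> supp b" for x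
    proof -
      have "lead r < lead a + x" using b(1) that lr(1) unfolding P_def r_def by blast
      then show ?thesis by (simp add: z_def algebra_simps)
    qed
    have zb: "coeff b z = 0" using small[of z] by (auto simp: supp_def)
    define b' where "b' = b + single c z"
    have ccoeff: "coeff b' x = (if x = z then c else coeff b x)" for x
      using zb by (simp add: b'_def)
    have "le b b'" unfolding le_def using small ccoeff by (metis not_le)
    moreover have "b' \<in> P" unfolding P_def
    proof safe
      fix x y assume x: "x \<in> supp b'" and y: "y \<in> supp (1 - a * b')"
      have eq: "1 - a * b' = r - single c z * a" by (simp add: r_def b'_def algebra_simps)
      have cs: "coeff (single c z * a) y = c * coeff a (y - z)" for y
      proof -
        have "coeff (single c z * a) y = (\<Sum>w\<in>{z}. coeff (single c z) w * coeff a (y - w))"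
          by (rule coeff_times_superset) (auto split: if_splits)
        then show ?thesis by simp
      qed
      have ne: "coeff r y \<noteq> c * coeff a (y - z)"
        using y unfolding eq supp_def by (simp add: cs)
      have "y \<noteq> lead r" using ne la(1) by (auto simp: z_def c_def supp_def)
      moreover have "y \<le> lead r"
      proof (cases "coeff r y = 0")
        case True
        then have "y - z \<in> supp a" using ne by (auto simp: supp_def)
        then have "y - z \<le> lead a" by (rule la(2))
        then show ?thesis by (simp add: z_def algebra_simps)
      next
        case False
        then show ?thesis using lr(2) by (simp add: supp_def)
      qed
      ultimately have "y < lead a + z" by (simp add: z_def)
      also have "z \<le> x" using x small ccoeff by (auto simp: supp_def less_imp_le split: if_splits)
      finally show "y < lead a + x" by simp
    qed
    ultimately have "b' = b" by (rule b(2)[rotated])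
    then show False using ccoeff[of z] zb c0 by simp
  qed
  then show ?thesis by auto
qed

instance hahn :: (linordered_ab_group_add) linordered_field
proof
  fix a b :: "'a hahn"
  show "inverse a * a = 1" if a0: "a \<noteq> 0"
  proof -
    obtain b where b: "a * b = 1" using hahn_inverse_exists[OF a0] by blast
    have "(THE b. a * b = 1) = b"
      using b a0 by (intro the_equality) (metis mult_left_cancel)+
    then show ?thesis using b a0 by (simp add: inverse_hahn_def mult.commute)
  qed
  show "a / b = a * inverse b" by (simp add: divide_hahn_def)
  show "inverse (0::'a hahn) = 0" by (simp add: inverse_hahn_def)
qed


section \<open>Monomials, dominance and summable families\<close>

definition hahn_group :: "'p::linorder set \<Rightarrow> 'p hahn set" where
  "hahn_group \<Phi> = {\<gamma>. supp \<gamma> \<subseteq> \<Phi>}"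

definition monomial_subgroup :: "'p::linorder set \<Rightarrow> 'p hahn set \<Rightarrow> bool" where
  "monomial_subgroup \<Phi> \<Gamma> \<longleftrightarrow>
    \<Gamma> \<subseteq> hahn_group \<Phi> \<and> 0 \<in> \<Gamma> \<and> (\<forall>\<alpha>\<in>\<Gamma>. \<forall>\<beta>\<in>\<Gamma>. \<alpha> + \<beta> \<in> \<Gamma>) \<and> (\<forall>\<alpha>\<in>\<Gamma>. - \<alpha> \<in> \<Gamma>) \<and>
    monomial ` \<Phi> \<subseteq> \<Gamma>"

text \<open>The field \<open>\<real>((\<Gamma>))\<close>, as a subfield of the field of all series with monomials in
  \<open>'g\<close>; a quotient of two of its elements computed in \<open>'g hahn\<close> is the one computed inside it.\<close>
definition series_field :: "'g::linordered_ab_group_add set \<Rightarrow> 'g hahn set" where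
  "series_field \<Gamma> = {a. supp a \<subseteq> \<Gamma>}"

text \<open>\<^term>\<open>None\<close> is the formal leading monomial of \<open>0\<close>, below all others in the order of
  \<^theory>\<open>HOL-Library.Option_ord\<close>.\<close>
definition LM :: "'g::linorder hahn \<Rightarrow> 'g option" where
  "LM a = (if a = 0 then None else Some (lead a))"

definition dominated :: "'g::linorder hahn \<Rightarrow> 'g hahn \<Rightarrow> bool" (infix \<open>\<preceq>\<close> 50) where
  "a \<preceq> b \<longleftrightarrow> LM a \<le> LM b"

definition strictly_dominated :: "'g::linorder hahn \<Rightarrow> 'g hahn \<Rightarrow> bool" (infix \<open>\<prec>\<close> 50) where
  "a \<prec> b \<longleftrightarrow> LM a < LM b"

definition dom_equiv :: "'g::linorder hahn \<Rightarrow> 'g hahn \<Rightarrow> bool" (infix \<open>\<asymp>\<close> 50) where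
  "a \<asymp> b \<longleftrightarrow> LM a = LM b"

text \<open>Leading fundamental monomial, as an element of the Hahn group, since the trivial monomial
  (here \<open>0\<close>) is its own value.\<close>
definition LF :: "'p::linorder hahn \<Rightarrow> 'p hahn" where
  "LF \<gamma> = (if \<gamma> = 0 then 0 else monomial (lead \<gamma>))"

definition comparable :: "'p::linorder hahn hahn \<Rightarrow> 'p hahn hahn \<Rightarrow> bool" where
  "comparable a b \<longleftrightarrow> LF (lead a) = LF (lead b)"

definition summable_family :: "('i \<Rightarrow> 'g::linorder hahn) \<Rightarrow> 'i set \<Rightarrow> bool" where
  "summable_family a I \<longleftrightarrow>
    anti_well_ordered (\<Union>i\<in>I. supp (a i)) \<and> (\<forall>\<alpha>. finite {i\<in>I. \<alpha> \<in> supp (a i)})"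

text \<open>Meaningful for summable families only.\<close>
definition family_sum :: "('i \<Rightarrow> 'g::linorder hahn) \<Rightarrow> 'i set \<Rightarrow> 'g hahn" where
  "family_sum a I = Abs_hahn (\<lambda>\<alpha>. \<Sum>i | i \<in> I \<and> \<alpha> \<in> supp (a i). coeff (a i) \<alpha>)"

lemma coeff_family_sum:
  assumes "summable_family a I"
  shows "coeff (family_sum a I) \<alpha> = (\<Sum>i | i \<in> I \<and> \<alpha> \<in> supp (a i). coeff (a i) \<alpha>)"
proof -
  have "{\<alpha>. (\<Sum>i | i \<in> I \<and> \<alpha> \<in> supp (a i). coeff (a i) \<alpha>) \<noteq> 0} \<subseteq> (\<Union>i\<in>I. supp (a i))"
    by (auto elim: sum.not_neutral_contains_not_neutral)
  then have "anti_well_ordered {\<alpha>. (\<Sum>i | i \<in> I \<and> \<alpha> \<in> supp (a i). coeff (a i) \<alpha>) \<noteq> 0}"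
    using assms anti_well_ordered_subset unfolding summable_family_def by blast
  then show ?thesis unfolding family_sum_def by (simp add: Abs_hahn_inverse)
qed


section \<open>Series derivations\<close>

text \<open>The fundamental monomial \<open>\<phi>\<close> as a series, and the logarithmic derivative of a series.\<close>
abbreviation fund :: "'p::linorder \<Rightarrow> 'p hahn hahn" where
  "fund \<phi> \<equiv> monomial (monomial \<phi>)"

abbreviation logder :: "('p::linorder hahn hahn \<Rightarrow> 'p hahn hahn) \<Rightarrow> 'p hahn hahn \<Rightarrow> 'p hahn hahn" where
  "logder d a \<equiv> d a / a"

definition series_derivation ::
    "'p::linorder hahn set \<Rightarrow> ('p hahn hahn \<Rightarrow> 'p hahn hahn) \<Rightarrow> bool" where
  "series_derivation \<Gamma> d \<longleftrightarrow>
    (\<forall>a\<in>series_field \<Gamma>. d a \<in> series_field \<Gamma>) \<and>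
    d 1 = 0 \<and>
    (\<forall>\<alpha>\<in>\<Gamma>. summable_family (\<lambda>\<phi>. logder d (fund \<phi>)) (supp \<alpha>) \<and>
      d (monomial \<alpha>) =
        monomial \<alpha> * family_sum (\<lambda>\<phi>. coeff \<alpha> \<phi> *\<^sub>R logder d (fund \<phi>)) (supp \<alpha>)) \<and>
    (\<forall>a\<in>series_field \<Gamma>. summable_family (\<lambda>\<alpha>. d (monomial \<alpha>)) (supp a) \<and>
      d a = family_sum (\<lambda>\<alpha>. coeff a \<alpha> *\<^sub>R d (monomial \<alpha>)) (supp a))"

definition theta :: "('p::linorder hahn hahn \<Rightarrow> 'p hahn hahn) \<Rightarrow> 'p \<Rightarrow> 'p hahn" where
  "theta d \<phi> = lead (logder d (fund \<phi>))"

definition HD2 :: "'p::linorder hahn set \<Rightarrow> ('p hahn hahn \<Rightarrow> 'p hahn hahn) \<Rightarrow> bool" where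
  "HD2 \<Gamma> d \<longleftrightarrow>
    (\<forall>a\<in>series_field \<Gamma> - {0}. \<forall>b\<in>series_field \<Gamma> - {0}.
      \<not> a \<asymp> 1 \<longrightarrow> \<not> b \<asymp> 1 \<longrightarrow> (a \<preceq> b \<longleftrightarrow> d a \<preceq> d b))"

definition HD3 :: "'p::linorder hahn set \<Rightarrow> ('p hahn hahn \<Rightarrow> 'p hahn hahn) \<Rightarrow> bool" where
  "HD3 \<Gamma> d \<longleftrightarrow>
    (\<forall>a\<in>series_field \<Gamma>. \<forall>b\<in>series_field \<Gamma>. 1 \<prec> \<bar>b\<bar> \<longrightarrow> \<bar>b\<bar> \<prec> \<bar>a\<bar> \<longrightarrow>
      logder d b \<preceq> logder d a \<and>
      (logder d a \<asymp> logder d b \<longleftrightarrow> comparable a b))"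

text \<open>The quotient of monomials is a difference in the additive notation for monomials.\<close>
definition H3' :: "'p::linorder set \<Rightarrow> ('p hahn hahn \<Rightarrow> 'p hahn hahn) \<Rightarrow> bool" where
  "H3' \<Phi> d \<longleftrightarrow>
    (\<forall>\<phi>\<in>\<Phi>. \<forall>\<psi>\<in>\<Phi>. \<phi> < \<psi> \<longrightarrow>
      theta d \<phi> < theta d \<psi> \<and> LF (theta d \<phi> - theta d \<psi>) < monomial \<psi>)"

end

theory Submission
  imports Defs
begin

text \<open>
  Everything reduces to one formula for leading monomials, written multiplicatively here.  If \<open>\<theta>\<close> is strictly increasing on \<open>\<Phi>\<close>,
  then in the sum defining the logarithmic derivative of a monomial \<open>\<alpha> \<noteq> 1\<close> the term of the leading
  fundamental monomial strictly dominates all others, so that \<open>\<alpha>'\<close> has leading monomial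
  \<open>\<alpha> \<theta>(LF \<alpha>)\<close> (lemma \<open>lead_derivation_monomial\<close>).  Write \<open>D \<alpha>\<close> for that monomial.

  Assume (H3').  For \<open>\<alpha> \<prec> \<beta>\<close>, both different from \<open>1\<close>, the quotient of \<open>\<theta>(LF \<beta>)\<close> by
  \<open>\<theta>(LF \<alpha>)\<close> is too small, in the sense of \<open>LF\<close>, to push \<open>\<beta> / \<alpha>\<close> below \<open>1\<close>, hence \<open>D\<close> is
  strictly increasing.  So the derivative of the leading term of \<open>a\<close>, if \<open>LM a \<noteq> 1\<close>, dominates the
  derivatives of the other terms, and \<open>a'\<close> has leading monomial \<open>D (LM a)\<close>.  Then (HD2) says that
  \<open>D\<close> is strictly increasing, and (HD3) follows from the monotonicity of \<open>\<theta>\<close>, because \<open>a' / a\<close> has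
  leading monomial \<open>\<theta>(LF a)\<close>.

  Conversely, (HD3) for two fundamental monomials says that \<open>\<theta>\<close> is strictly increasing, so the
  formula for \<open>D\<close> is available.  Suppose that \<open>\<phi> \<prec> \<psi>\<close> violate the rest of (H3'), and apply (HD2)
  to \<open>\<alpha> = \<theta>(\<phi>) / \<theta>(\<psi>)\<close> and \<open>\<beta> = 1 / \<phi>\<close>.  With \<open>\<chi> = LF \<alpha> \<succeq> \<psi>\<close> one has \<open>\<alpha> \<prec> \<beta>\<close>, but
  \<open>D \<alpha> = \<theta>(\<phi>) \<theta>(\<chi>) / \<theta>(\<psi>) \<succeq> \<theta>(\<phi>) \<succ> \<theta>(\<phi>) / \<phi> = D \<beta>\<close>, a contradiction.
\<close>

section \<open>Leading monomials\<close>

lemma supp_single [simp]: "c \<noteq> 0 \<Longrightarrow> supp (single c x) = {x}"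
  by (auto simp: supp_def)

lemma single_neq_0 [simp]: "c \<noteq> 0 \<Longrightarrow> single c x \<noteq> 0"
  by (simp add: hahn_eq_0_iff)

lemma lead_single [simp]: "c \<noteq> 0 \<Longrightarrow> lead (single c x) = x"
  by (rule lead_eqI) simp_all

lemma supp_uminus [simp]: "supp (- a) = supp a"
  by (simp add: supp_def)

lemma lead_uminus [simp]: "lead (- a) = lead a"
  by (simp add: lead_def)

lemma lead_abs [simp]: "lead \<bar>a\<bar> = lead a" for a :: "'a::linordered_ab_group_add hahn"
  by (simp add: abs_if)

lemma supp_scaleR [simp]: "c \<noteq> 0 \<Longrightarrow> supp (c *\<^sub>R a) = supp a"
  by (simp add: supp_def)

lemma lead_scaleR [simp]: "c \<noteq> 0 \<Longrightarrow> lead (c *\<^sub>R a) = lead a"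
  by (simp add: lead_def)

lemma coeff_lead_neq_0: "a \<noteq> 0 \<Longrightarrow> coeff a (lead a) \<noteq> 0"
  using lead_props(1)[of a] by (simp add: supp_def)

lemma lead_mult:
  fixes a b :: "'a::linordered_ab_group_add hahn"
  assumes "a \<noteq> 0" "b \<noteq> 0"
  shows "lead (a * b) = lead a + lead b"
  using lead_times[OF assms] coeff_lead_neq_0 assms
  by (intro lead_eqI) (auto simp: supp_def)

lemma lead_divide:
  fixes a b :: "'a::linordered_ab_group_add hahn"
  assumes "a \<noteq> 0" "b \<noteq> 0"
  shows "lead (a / b) = lead a - lead b"
  using lead_mult[of "a / b" b] assms by (simp add: algebra_simps)

lemma dominated_iff_lead_le: "a \<noteq> 0 \<Longrightarrow> b \<noteq> 0 \<Longrightarrow> a \<preceq> b \<longleftrightarrow> lead a \<le> lead b"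
  by (simp add: dominated_def LM_def)

lemma strictly_dominated_iff: "a \<prec> b \<longleftrightarrow> b \<noteq> 0 \<and> (a = 0 \<or> lead a < lead b)"
  by (simp add: strictly_dominated_def LM_def)

lemma dom_equiv_iff_lead_eq: "a \<noteq> 0 \<Longrightarrow> b \<noteq> 0 \<Longrightarrow> a \<asymp> b \<longleftrightarrow> lead a = lead b"
  by (simp add: dom_equiv_def LM_def)

lemma not_dom_equiv_one_iff:
  "a \<noteq> 0 \<Longrightarrow> \<not> a \<asymp> 1 \<longleftrightarrow> lead a \<noteq> 0" for a :: "'a::linordered_ab_group_add hahn"
  by (simp add: dom_equiv_iff_lead_eq one_hahn_eq_monomial)

text \<open>The strictly dominant member of a summable family cannot be cancelled, so it determines the
  leading monomial of the sum.\<close>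

lemma family_sum_dominant:
  assumes sm: "summable_family a I" and i: "i \<in> I" and nz: "a i \<noteq> 0"
    and dom: "\<And>j. j \<in> I \<Longrightarrow> j \<noteq> i \<Longrightarrow> a j \<prec> a i"
  shows "family_sum a I \<noteq> 0" "lead (family_sum a I) = lead (a i)"
proof -
  have only: "j = i" if "j \<in> I" "x \<in> supp (a j)" "lead (a i) \<le> x" for j x
  proof (rule ccontr)
    assume "j \<noteq> i"
    moreover have "a j \<noteq> 0" using that(2) by (auto simp: hahn_eq_0_iff)
    ultimately have "lead (a j) < lead (a i)" using dom[OF that(1)] by (simp add: strictly_dominated_iff)
    then show False using that lead_props(2)[OF \<open>a j \<noteq> 0\<close> that(2)] by simp
  qed
  have "{j. j \<in> I \<and> lead (a i) \<in> supp (a j)} = {i}"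
    using only lead_props(1)[OF nz] i by blast
  then have c: "coeff (family_sum a I) (lead (a i)) \<noteq> 0"
    by (simp add: coeff_family_sum[OF sm] coeff_lead_neq_0 nz)
  show "lead (family_sum a I) = lead (a i)"
  proof (rule lead_eqI)
    fix x assume "x \<in> supp (family_sum a I)"
    then obtain j where j: "j \<in> I" "x \<in> supp (a j)"
      unfolding supp_def[of "family_sum a I"]
      by (auto simp: coeff_family_sum[OF sm] elim: sum.not_neutral_contains_not_neutral)
    show "x \<le> lead (a i)"
      using only[OF j] lead_props(2)[OF nz] j by (metis linear)
  qed (use c in \<open>simp add: supp_def\<close>)
  show "family_sum a I \<noteq> 0" using c by auto
qed

lemma summable_family_scaleR:
  assumes "summable_family a I" "\<And>i. i \<in> I \<Longrightarrow> c i \<noteq> 0"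
  shows "summable_family (\<lambda>i. c i *\<^sub>R a i) I"
  using assms unfolding summable_family_def by (simp cong: conj_cong)

section \<open>The order of the Hahn group\<close>

lemma hahn_pos_iff_coeff_lead: "0 < \<gamma> \<longleftrightarrow> \<gamma> \<noteq> 0 \<and> 0 < coeff \<gamma> (lead \<gamma>)" for \<gamma> :: "'a::linorder hahn"
  by (simp add: less_hahn_def)

lemma hahn_add_pos_of_lead_less:
  fixes \<gamma> \<delta> :: "'a::linorder hahn"
  assumes "0 < \<gamma>" "\<delta> = 0 \<or> lead \<delta> < lead \<gamma>"
  shows "0 < \<gamma> + \<delta>"
proof -
  have g: "\<gamma> \<noteq> 0" "0 < coeff \<gamma> (lead \<gamma>)" using assms(1) by (simp_all add: hahn_pos_iff_coeff_lead)
  have small: "x < lead \<gamma>" if "coeff \<delta> x \<noteq> 0" for x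
    using that assms(2) lead_props(2)[of \<delta> x] by (force simp: supp_def)
  have "coeff \<delta> (lead \<gamma>) = 0" using small by blast
  moreover have "x \<le> lead \<gamma>" if "coeff (\<gamma> + \<delta>) x \<noteq> 0" for x
    using that small[of x] lead_props(2)[OF g(1), of x]
    by (cases "coeff \<delta> x = 0") (auto simp: supp_def)
  ultimately show ?thesis unfolding hahn_pos_iff using g(2) by (intro exI[of _ "lead \<gamma>"]) auto
qed

lemma lead_mono_pos:
  fixes \<alpha> \<beta> :: "'a::linorder hahn"
  assumes "0 < \<alpha>" "\<alpha> < \<beta>"
  shows "lead \<alpha> \<le> lead \<beta>"
proof (rule ccontr)
  assume "\<not> lead \<alpha> \<le> lead \<beta>"
  then have "0 < \<alpha> + - \<beta>" using assms(1) by (intro hahn_add_pos_of_lead_less) auto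
  then show False using assms(2) by simp
qed

lemma lead_diff_of_neq:
  fixes \<alpha> \<beta> :: "'a::linorder hahn"
  assumes "\<alpha> \<noteq> 0" "\<beta> \<noteq> 0" "lead \<alpha> \<noteq> lead \<beta>"
  shows "lead (\<beta> - \<alpha>) = max (lead \<alpha>) (lead \<beta>)"
proof (rule lead_eqI)
  have "coeff \<alpha> x = 0" if "lead \<alpha> < x" for x
    using that lead_props(2)[OF assms(1), of x] by (force simp: supp_def)
  moreover have "coeff \<beta> x = 0" if "lead \<beta> < x" for x
    using that lead_props(2)[OF assms(2), of x] by (force simp: supp_def)
  ultimately show "max (lead \<alpha>) (lead \<beta>) \<in> supp (\<beta> - \<alpha>)"
    using assms coeff_lead_neq_0[of \<alpha>] coeff_lead_neq_0[of \<beta>] by (auto simp: supp_def max_def)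
next
  fix x assume "x \<in> supp (\<beta> - \<alpha>)"
  then have "x \<in> supp \<alpha> \<or> x \<in> supp \<beta>" by (auto simp: supp_def)
  then show "x \<le> max (lead \<alpha>) (lead \<beta>)"
    using lead_props(2)[OF assms(1)] lead_props(2)[OF assms(2)] by (auto simp: le_max_iff_disj)
qed

lemma monomial_pos: "0 < (monomial x :: 'a::linorder hahn)"
  by (simp add: hahn_pos_iff_coeff_lead)

lemma monomial_less_iff: "(monomial x :: 'a::linorder hahn) < monomial y \<longleftrightarrow> x < y"
proof -
  have less: "(monomial x :: 'a hahn) < monomial y" if "x < y" for x y
    using hahn_add_pos_of_lead_less[of "monomial y" "- monomial x"] that monomial_pos[of y] by simp
  show ?thesis using less[of x y] less[of y x] by (metis less_asym linorder_neqE)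
qed

lemma LF_less_monomial_iff: "LF \<gamma> < monomial \<psi> \<longleftrightarrow> \<gamma> = 0 \<or> lead \<gamma> < \<psi>"
  by (simp add: LF_def monomial_pos monomial_less_iff)

lemma LF_eq_iff: "\<alpha> \<noteq> 0 \<Longrightarrow> \<beta> \<noteq> 0 \<Longrightarrow> LF \<alpha> = LF \<beta> \<longleftrightarrow> lead \<alpha> = lead \<beta>"
  by (auto simp: LF_def dest: arg_cong[of _ _ lead])

section \<open>Leading monomials of derivatives\<close>

locale nondegenerate_series_derivation =
  fixes \<Phi> :: "'p::linorder set"
    and \<Gamma> :: "'p hahn set"
    and d :: "'p hahn hahn \<Rightarrow> 'p hahn hahn"
  assumes subgroup: "monomial_subgroup \<Phi> \<Gamma>"
    and derivation: "series_derivation \<Gamma> d"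
    and fund_nonzero: "\<forall>\<phi>\<in>\<Phi>. d (fund \<phi>) \<noteq> 0"
begin

abbreviation \<theta> :: "'p \<Rightarrow> 'p hahn" where "\<theta> \<equiv> theta d"

lemma supp_subset: "\<alpha> \<in> \<Gamma> \<Longrightarrow> supp \<alpha> \<subseteq> \<Phi>"
  using subgroup by (auto simp: monomial_subgroup_def hahn_group_def)

lemma lead_in: "\<alpha> \<in> \<Gamma> \<Longrightarrow> \<alpha> \<noteq> 0 \<Longrightarrow> lead \<alpha> \<in> \<Phi>"
  using supp_subset lead_props(1) by blast

lemma monomial_in: "\<phi> \<in> \<Phi> \<Longrightarrow> monomial \<phi> \<in> \<Gamma>"
  using subgroup by (auto simp: monomial_subgroup_def)

lemma uminus_in: "\<alpha> \<in> \<Gamma> \<Longrightarrow> - \<alpha> \<in> \<Gamma>"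
  using subgroup by (auto simp: monomial_subgroup_def)

lemma diff_in: "\<alpha> \<in> \<Gamma> \<Longrightarrow> \<beta> \<in> \<Gamma> \<Longrightarrow> \<alpha> - \<beta> \<in> \<Gamma>"
  using subgroup uminus_in unfolding monomial_subgroup_def by (metis diff_conv_add_uminus)

lemma monomial_in_series_field: "\<alpha> \<in> \<Gamma> \<Longrightarrow> monomial \<alpha> \<in> series_field \<Gamma>"
  by (simp add: series_field_def)

lemma theta_in:
  assumes "\<phi> \<in> \<Phi>"
  shows "\<theta> \<phi> \<in> \<Gamma>"
proof -
  have "d (fund \<phi>) \<in> series_field \<Gamma>"
    using derivation monomial_in_series_field[OF monomial_in[OF assms]]
    unfolding series_derivation_def by blast
  then have "lead (d (fund \<phi>)) \<in> \<Gamma>"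
    using lead_props(1) fund_nonzero assms by (auto simp: series_field_def)
  then show ?thesis
    using fund_nonzero assms by (simp add: theta_def lead_divide diff_in monomial_in)
qed

text \<open>Strict monotonicity of \<open>\<theta>\<close> rules out cancellation in the (possibly infinite) sum that defines
  the logarithmic derivative of \<open>\<alpha>\<close>; the leading fundamental monomial of \<open>\<alpha>\<close> gives its dominant
  term.\<close>

lemma lead_derivation_monomial:
  assumes mono: "strict_mono_on \<Phi> \<theta>" and \<alpha>: "\<alpha> \<in> \<Gamma>" "\<alpha> \<noteq> 0"
  shows "d (monomial \<alpha>) \<noteq> 0" "lead (d (monomial \<alpha>)) = \<alpha> + \<theta> (lead \<alpha>)"
proof -
  define t where "t = (\<lambda>\<phi>. coeff \<alpha> \<phi> *\<^sub>R logder d (fund \<phi>))"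
  have sm: "summable_family (\<lambda>\<phi>. logder d (fund \<phi>)) (supp \<alpha>)"
    and d\<alpha>: "d (monomial \<alpha>) = monomial \<alpha> * family_sum t (supp \<alpha>)"
    using derivation \<alpha>(1) by (simp_all add: series_derivation_def t_def)
  have t: "t \<phi> \<noteq> 0" "lead (t \<phi>) = \<theta> \<phi>" if "\<phi> \<in> supp \<alpha>" for \<phi>
    using that fund_nonzero supp_subset[OF \<alpha>(1)] by (auto simp: t_def theta_def supp_def)
  note top = lead_props[OF \<alpha>(2)]
  have st: "summable_family t (supp \<alpha>)"
    unfolding t_def using sm by (rule summable_family_scaleR) (simp add: supp_def)
  have dom: "t \<phi> \<prec> t (lead \<alpha>)" if "\<phi> \<in> supp \<alpha>" "\<phi> \<noteq> lead \<alpha>" for \<phi>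
  proof -
    have "\<phi> < lead \<alpha>" using top(2) that by (simp add: less_le)
    then have "\<theta> \<phi> < \<theta> (lead \<alpha>)"
      using strict_mono_onD[OF mono] that(1) top(1) supp_subset[OF \<alpha>(1)] by blast
    then show ?thesis using t that(1) top(1) by (simp add: strictly_dominated_iff)
  qed
  note s = family_sum_dominant[OF st top(1) t(1)[OF top(1)] dom]
  show "d (monomial \<alpha>) \<noteq> 0" "lead (d (monomial \<alpha>)) = \<alpha> + \<theta> (lead \<alpha>)"
    using s t(2)[OF top(1)] by (simp_all add: d\<alpha> lead_mult)
qed

text \<open>The leading monomial of \<open>\<theta>(\<phi>) / \<theta>(\<psi>)\<close> matters only through its comparison with the larger of
  \<open>\<phi>\<close> and \<open>\<psi>\<close>, which is the leading fundamental monomial of \<open>\<beta> / \<alpha>\<close> when \<open>LF \<alpha> = \<phi>\<close> and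
  \<open>LF \<beta> = \<psi>\<close> differ: so the correction by \<open>\<theta>\<close> never outweighs \<open>\<beta> / \<alpha>\<close>.\<close>

lemma H3'_leading_derivative_mono:
  assumes h: "H3' \<Phi> d" and \<alpha>: "\<alpha> \<in> \<Gamma>" "\<alpha> \<noteq> 0" and \<beta>: "\<beta> \<in> \<Gamma>" "\<beta> \<noteq> 0" and less: "\<alpha> < \<beta>"
  shows "\<alpha> + \<theta> (lead \<alpha>) < \<beta> + \<theta> (lead \<beta>)"
proof (cases "lead \<alpha> = lead \<beta>")
  case True
  then show ?thesis using less by simp
next
  case False
  define \<delta> where "\<delta> = \<theta> (lead \<beta>) - \<theta> (lead \<alpha>)"
  have \<delta>_minus: "- \<delta> = \<theta> (lead \<alpha>) - \<theta> (lead \<beta>)" by (simp add: \<delta>_def)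
  have small: "\<theta> \<phi> - \<theta> \<psi> = 0 \<or> lead (\<theta> \<phi> - \<theta> \<psi>) < \<psi>" if "\<phi> \<in> \<Phi>" "\<psi> \<in> \<Phi>" "\<phi> < \<psi>" for \<phi> \<psi>
    using h that by (auto simp: H3'_def LF_less_monomial_iff)
  have "\<delta> = 0 \<or> lead \<delta> < max (lead \<alpha>) (lead \<beta>)"
  proof (cases "lead \<alpha> < lead \<beta>")
    case True
    then have "- \<delta> = 0 \<or> lead (- \<delta>) < lead \<beta>"
      unfolding \<delta>_minus by (intro small lead_in \<alpha> \<beta>)
    then show ?thesis by (auto simp: less_max_iff_disj)
  next
    case notless: False
    then have "lead \<beta> < lead \<alpha>" using False by simp
    then have "\<delta> = 0 \<or> lead \<delta> < lead \<alpha>"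
      unfolding \<delta>_def by (intro small lead_in \<alpha> \<beta>)
    then show ?thesis by (auto simp: less_max_iff_disj)
  qed
  then have "0 < (\<beta> - \<alpha>) + \<delta>"
    using less by (intro hahn_add_pos_of_lead_less) (simp_all add: lead_diff_of_neq \<alpha> \<beta> False)
  then show ?thesis by (simp add: \<delta>_def algebra_simps)
qed

lemma H3'_strict_mono_theta: "H3' \<Phi> d \<Longrightarrow> strict_mono_on \<Phi> \<theta>"
  by (auto simp: H3'_def intro!: strict_mono_onI)

text \<open>By the previous lemma the derivative of the leading term dominates those of the other terms.
  The constant term, for which that lemma says nothing, has derivative \<open>0\<close>.\<close>

lemma H3'_lead_derivation:
  assumes h: "H3' \<Phi> d" and a: "a \<in> series_field \<Gamma>" "a \<noteq> 0" "lead a \<noteq> 0"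
  shows "d a \<noteq> 0" "lead (d a) = lead a + \<theta> (lead (lead a))"
proof -
  define t where "t = (\<lambda>\<alpha>. coeff a \<alpha> *\<^sub>R d (monomial \<alpha>))"
  have sm: "summable_family (\<lambda>\<alpha>. d (monomial \<alpha>)) (supp a)" and da: "d a = family_sum t (supp a)"
    using derivation a(1) by (simp_all add: series_derivation_def t_def)
  have sub: "supp a \<subseteq> \<Gamma>" using a(1) by (simp add: series_field_def)
  note ld = lead_derivation_monomial[OF H3'_strict_mono_theta[OF h]]
  have t: "t \<alpha> \<noteq> 0" "lead (t \<alpha>) = \<alpha> + \<theta> (lead \<alpha>)" if "\<alpha> \<in> supp a" "\<alpha> \<noteq> 0" for \<alpha>
    using that ld sub by (auto simp: t_def supp_def)
  have t0: "t 0 = 0"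
    using derivation by (simp add: t_def series_derivation_def flip: one_hahn_eq_monomial)
  note top = lead_props[OF a(2)]
  note tt = t[OF top(1) a(3)]
  have dom: "t \<alpha> \<prec> t (lead a)" if "\<alpha> \<in> supp a" "\<alpha> \<noteq> lead a" for \<alpha>
  proof (cases "\<alpha> = 0")
    case True
    then show ?thesis using tt t0 by (simp add: strictly_dominated_iff)
  next
    case False
    have "\<alpha> < lead a" using top(2) that by (simp add: less_le)
    then have "\<alpha> + \<theta> (lead \<alpha>) < lead a + \<theta> (lead (lead a))"
      using that(1) False sub top(1) a(3) by (intro H3'_leading_derivative_mono[OF h]) auto
    then show ?thesis using tt t[OF that(1) False] by (simp add: strictly_dominated_iff)
  qed
  have "summable_family t (supp a)"
    unfolding t_def using sm by (rule summable_family_scaleR) (simp add: supp_def)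
  from family_sum_dominant[OF this top(1) tt(1) dom]
  show "d a \<noteq> 0" "lead (d a) = lead a + \<theta> (lead (lead a))"
    using tt(2) by (simp_all add: da)
qed

section \<open>Equivalence with monotonicity of the derivation\<close>

lemma H3'_imp_HD2:
  assumes h: "H3' \<Phi> d"
  shows "HD2 \<Gamma> d"
  unfolding HD2_def
proof (intro ballI impI)
  fix a b assume "a \<in> series_field \<Gamma> - {0}" "b \<in> series_field \<Gamma> - {0}" "\<not> a \<asymp> 1" "\<not> b \<asymp> 1"
  then have a: "a \<in> series_field \<Gamma>" "a \<noteq> 0" "lead a \<noteq> 0" and b: "b \<in> series_field \<Gamma>" "b \<noteq> 0" "lead b \<noteq> 0"
    by (auto simp: not_dom_equiv_one_iff)
  have G: "lead a \<in> \<Gamma>" "lead b \<in> \<Gamma>"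
    using a b lead_props(1) by (auto simp: series_field_def)
  note da = H3'_lead_derivation[OF h a] and db = H3'_lead_derivation[OF h b]
  have "lead a \<le> lead b \<longleftrightarrow> lead a + \<theta> (lead (lead a)) \<le> lead b + \<theta> (lead (lead b))"
    using H3'_leading_derivative_mono[OF h G(1) a(3) G(2) b(3)]
      H3'_leading_derivative_mono[OF h G(2) b(3) G(1) a(3)]
    by (metis less_le not_le order_refl)
  then show "a \<preceq> b \<longleftrightarrow> d a \<preceq> d b"
    using a b da db by (simp add: dominated_iff_lead_le)
qed

lemma H3'_imp_HD3:
  assumes h: "H3' \<Phi> d"
  shows "HD3 \<Gamma> d"
  unfolding HD3_def
proof (intro ballI impI)
  fix a b assume ab: "a \<in> series_field \<Gamma>" "b \<in> series_field \<Gamma>" "1 \<prec> \<bar>b\<bar>" "\<bar>b\<bar> \<prec> \<bar>a\<bar>"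
  then have nz: "a \<noteq> 0" "b \<noteq> 0" and less: "0 < lead b" "lead b < lead a"
    by (auto simp: strictly_dominated_iff one_hahn_eq_monomial)
  then have lnz: "lead a \<noteq> 0" "lead b \<noteq> 0" by auto
  have ld: "logder d c \<noteq> 0" "lead (logder d c) = \<theta> (lead (lead c))"
    if "c \<in> series_field \<Gamma>" "c \<noteq> 0" "lead c \<noteq> 0" for c
    using H3'_lead_derivation[OF h that] that(2) by (simp_all add: lead_divide)
  note da = ld[OF ab(1) nz(1) lnz(1)] and db = ld[OF ab(2) nz(2) lnz(2)]
  have lin: "lead (lead a) \<in> \<Phi>" "lead (lead b) \<in> \<Phi>"
    using ab lead_props(1) nz lnz by (auto intro!: lead_in simp: series_field_def)
  have le: "lead (lead b) \<le> lead (lead a)" using less by (rule lead_mono_pos)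
  note mono = H3'_strict_mono_theta[OF h]
  have "\<theta> (lead (lead b)) \<le> \<theta> (lead (lead a))"
    using strict_mono_on_leD[OF mono lin(2,1) le] .
  moreover have "\<theta> (lead (lead a)) = \<theta> (lead (lead b)) \<longleftrightarrow> lead (lead a) = lead (lead b)"
    using strict_mono_on_eqD[OF mono _ lin] by auto
  ultimately show "logder d b \<preceq> logder d a \<and> (logder d a \<asymp> logder d b \<longleftrightarrow> comparable a b)"
    using da db lnz
    by (simp add: dominated_iff_lead_le dom_equiv_iff_lead_eq comparable_def LF_eq_iff del: divide_eq_0_iff)
qed

lemma HD3_strict_mono_theta:
  assumes h: "HD3 \<Gamma> d"
  shows "strict_mono_on \<Phi> \<theta>"
proof (rule strict_mono_onI)
  fix \<phi> \<psi> assume in\<Phi>: "\<phi> \<in> \<Phi>" "\<psi> \<in> \<Phi>" and less: "\<phi> < \<psi>"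
  have "1 \<prec> \<bar>fund \<phi>\<bar>" "\<bar>fund \<phi>\<bar> \<prec> \<bar>fund \<psi>\<bar>"
    using less by (simp_all add: strictly_dominated_iff one_hahn_eq_monomial monomial_pos monomial_less_iff)
  then have "logder d (fund \<phi>) \<preceq> logder d (fund \<psi>)"
    "logder d (fund \<psi>) \<asymp> logder d (fund \<phi>) \<longleftrightarrow> comparable (fund \<psi>) (fund \<phi>)"
    using h in\<Phi> monomial_in_series_field[OF monomial_in] unfolding HD3_def by blast+
  moreover have "\<not> comparable (fund \<psi>) (fund \<phi>)"
    using less by (simp add: comparable_def LF_eq_iff)
  moreover have "logder d (fund \<phi>) \<noteq> 0" "logder d (fund \<psi>) \<noteq> 0"
    using in\<Phi> fund_nonzero by simp_all
  ultimately have "\<theta> \<phi> \<le> \<theta> \<psi>" "\<theta> \<psi> \<noteq> \<theta> \<phi>"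
    by (simp_all add: theta_def dominated_iff_lead_le dom_equiv_iff_lead_eq del: divide_eq_0_iff)
  then show "\<theta> \<phi> < \<theta> \<psi>" by simp
qed

text \<open>The monomial \<open>\<theta>(\<phi>) / \<theta>(\<psi>)\<close> is itself the test element for (HD2).  That it lies in \<open>\<Gamma>\<close> is
  what makes the argument work for subgroups \<open>\<Gamma>\<close> that need not be closed under real powers.\<close>

lemma HD2_HD3_imp_H3':
  assumes hd2: "HD2 \<Gamma> d" and hd3: "HD3 \<Gamma> d"
  shows "H3' \<Phi> d"
  unfolding H3'_def
proof (intro ballI impI conjI)
  fix \<phi> \<psi> assume in\<Phi>: "\<phi> \<in> \<Phi>" "\<psi> \<in> \<Phi>" and less: "\<phi> < \<psi>"
  note mono = HD3_strict_mono_theta[OF hd3]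
  show th: "\<theta> \<phi> < \<theta> \<psi>" using strict_mono_onD[OF mono in\<Phi> less] .
  define \<alpha> where "\<alpha> = \<theta> \<phi> - \<theta> \<psi>"
  define \<beta> where "\<beta> = - monomial \<phi>"
  have \<alpha>: "\<alpha> \<in> \<Gamma>" "\<alpha> \<noteq> 0" "\<alpha> < 0"
    using th in\<Phi> by (simp_all add: \<alpha>_def theta_in diff_in)
  have \<beta>: "\<beta> \<in> \<Gamma>" "\<beta> \<noteq> 0" using in\<Phi> by (simp_all add: \<beta>_def monomial_in uminus_in)
  have "lead \<alpha> < \<psi>"
  proof (rule ccontr)
    assume big: "\<not> lead \<alpha> < \<psi>"
    have "0 < - \<alpha> + \<beta>"
      using \<alpha>(3) big less by (intro hahn_add_pos_of_lead_less) (auto simp: \<beta>_def)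
    then have "\<alpha> < \<beta>" by simp
    then have "monomial \<alpha> \<preceq> monomial \<beta>" by (simp add: dominated_iff_lead_le)
    moreover have "\<not> monomial \<alpha> \<asymp> 1" "\<not> monomial \<beta> \<asymp> 1"
      using \<alpha> \<beta> by (simp_all add: not_dom_equiv_one_iff)
    ultimately have "d (monomial \<alpha>) \<preceq> d (monomial \<beta>)"
      using hd2 \<alpha>(1) \<beta>(1) monomial_in_series_field unfolding HD2_def by simp
    then have "\<alpha> + \<theta> (lead \<alpha>) \<le> \<beta> + \<theta> (lead \<beta>)"
      using lead_derivation_monomial[OF mono] \<alpha> \<beta> by (simp add: dominated_iff_lead_le)
    then have "\<theta> \<phi> + (\<theta> (lead \<alpha>) - \<theta> \<psi>) \<le> \<theta> \<phi> - monomial \<phi>"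
      by (simp add: \<alpha>_def \<beta>_def algebra_simps)
    moreover have "\<theta> \<psi> \<le> \<theta> (lead \<alpha>)"
      using big in\<Phi> \<alpha> by (intro strict_mono_on_leD[OF mono] lead_in) simp_all
    ultimately have "monomial \<phi> \<le> 0"
      by (smt (verit) add_le_cancel_left diff_ge_0_iff_ge diff_conv_add_uminus neg_0_le_iff_le order_trans)
    then show False using monomial_pos[of \<phi>] by simp
  qed
  then show "LF (\<theta> \<phi> - \<theta> \<psi>) < monomial \<psi>" by (simp add: LF_less_monomial_iff \<alpha>_def)
qed

end

theorem theorem4p3:
  fixes \<Phi> :: "'p::linorder set"
    and \<Gamma> :: "'p hahn set"
    and d :: "'p hahn hahn \<Rightarrow> 'p hahn hahn"
  assumes "monomial_subgroup \<Phi> \<Gamma>"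
    and "series_derivation \<Gamma> d"
    and "\<forall>\<phi>\<in>\<Phi>. d (fund \<phi>) \<noteq> 0"
  shows "(HD2 \<Gamma> d \<and> HD3 \<Gamma> d) \<longleftrightarrow> H3' \<Phi> d"
proof -
  interpret nondegenerate_series_derivation \<Phi> \<Gamma> d
    using assms by unfold_locales
  show ?thesis using H3'_imp_HD2 H3'_imp_HD3 HD2_HD3_imp_H3' by blast
qed

end
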